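(* For every admissible value of the parameters, i.e. whenever $\alpha\ge 0$ and $hc+\alpha(r+\delta)<\frac{hp}{\epsilon}$, we have $$k^*_{mono} < k^*_{agents},$$ where $k^*_{mono}$ and $k^*_{agents}$ are the equilibrium capacities in the monopoly regime and in the competitive small agents regime, respectively.
   Context: The constants $r,\delta,\lambda,\epsilon,h,p>0$ and $c,\alpha\in\mathbb{R}$ are given, and $a^+=\max(a,0)$. Competitive small agents regime: $U:[0,\infty)\to\mathbb{R}$ is the unique globally Lipschitz solution (which is decreasing) of $$-(r+\delta)U + (\lambda(U-\alpha)-\delta k)U' + h\left(\frac{p}{k+\epsilon}-c\right)^+=0 .$$ Monopoly regime: $U:[0,\infty)\to\mathbb{R}$ is the unique globally Lipschitz solution (which is decreasing) of $$-(r+\delta)U + (\lambda(U-\alpha)-\delta k)U' + \frac{hp\epsilon}{(k+\epsilon)^2}-hc=0 .$$ In each regime the aggregate capacity evolves according to $\dot K_t=\lambda(U(K_t)-\alpha)-\delta K_t$, and the equilibrium capacity is the unique stationary state $k^*\ge 0$, i.e. the value with $\lambda(U(k^* )-\alpha)-\delta k^*=0$. Evaluating the equations at the stationary state, $k^*_{agents}$ is the $k$-component of the unique solution $(k,u)$ with $k\ge 0$ of $$\lambda(u-\alpha)-\delta k=0,\qquad (r+\delta)u=h\left(\frac{p}{k+\epsilon}-c\right)^+,$$ and $k^*_{mono}$ is the $k$-component of the unique solution $(k,u)$ with $k\ge 0$ of $$\lambda(u-\alpha)-\delta k=0,\qquad (r+\delta)u=\frac{hp\epsilon}{(k+\epsilon)^2}-hc.$$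 *)

theory Defs
  imports "HOL-Analysis.Analysis"
begin

definition agents_payoff :: "real \<Rightarrow> real \<Rightarrow> real \<Rightarrow> real \<Rightarrow> real \<Rightarrow> real" where
  "agents_payoff \<epsilon> h p c k = h * max (p / (k + \<epsilon>) - c) 0"

definition mono_payoff :: "real \<Rightarrow> real \<Rightarrow> real \<Rightarrow> real \<Rightarrow> real \<Rightarrow> real" where
  "mono_payoff \<epsilon> h p c k = h * p * \<epsilon> / (k + \<epsilon>)^2 - h * c"

text \<open>
  The rate \<open>lam\<close> stands for \<open>\<lambda>\<close>. The two regimes differ only in the source term \<open>f\<close> of the
  equation. Functions on the half-line \<open>[0,\<infinity>)\<close> are total functions of which only the restriction
  to \<open>{0..}\<close> matters; in particular the derivative at \<open>0\<close> is one-sided. Monotonicity is part of the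
  definition because being globally Lipschitz does not single out the solution: increasing globally
  Lipschitz solutions of the same equation exist as well.
\<close>

definition value_function ::
    "real \<Rightarrow> real \<Rightarrow> real \<Rightarrow> real \<Rightarrow> (real \<Rightarrow> real) \<Rightarrow> (real \<Rightarrow> real) \<Rightarrow> bool" where
  "value_function r \<delta> lam \<alpha> f U \<longleftrightarrow>
     (\<exists>L. L-lipschitz_on {0..} U) \<and>
     antimono_on {0..} U \<and>
     (\<forall>k\<ge>0. \<exists>D. (U has_real_derivative D) (at k within {0..}) \<and>
        - (r + \<delta>) * U k + (lam * (U k - \<alpha>) - \<delta> * k) * D + f k = 0)"

definition equilibrium_capacity ::
    "real \<Rightarrow> real \<Rightarrow> real \<Rightarrow> (real \<Rightarrow> real) \<Rightarrow> real" where
  "equilibrium_capacity \<delta> lam \<alpha> U = (THE k. k \<ge> 0 \<and> lam * (U k - \<alpha>) - \<delta> * k = 0)"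

text \<open>
  The equation evaluated at a stationary state, where the factor of the derivative vanishes.
\<close>

definition stationary_pair ::
    "real \<Rightarrow> real \<Rightarrow> real \<Rightarrow> real \<Rightarrow> (real \<Rightarrow> real) \<Rightarrow> real \<times> real" where
  "stationary_pair r \<delta> lam \<alpha> f =
     (THE (k, u). k \<ge> 0 \<and> lam * (u - \<alpha>) - \<delta> * k = 0 \<and> (r + \<delta>) * u = f k)"

definition k_agents ::
    "real \<Rightarrow> real \<Rightarrow> real \<Rightarrow> real \<Rightarrow> real \<Rightarrow> real \<Rightarrow> real \<Rightarrow> real \<Rightarrow> real" where
  "k_agents r \<delta> lam \<epsilon> h p c \<alpha> = fst (stationary_pair r \<delta> lam \<alpha> (agents_payoff \<epsilon> h p c))"

definition k_mono ::
    "real \<Rightarrow> real \<Rightarrow> real \<Rightarrow> real \<Rightarrow> real \<Rightarrow> real \<Rightarrow> real \<Rightarrow> real \<Rightarrow> real" where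
  "k_mono r \<delta> lam \<epsilon> h p c \<alpha> = fst (stationary_pair r \<delta> lam \<alpha> (mono_payoff \<epsilon> h p c))"

end

theory Submission
  imports Defs
begin

text \<open>
  At a stationary state \<open>u = \<alpha> + \<delta> k / \<lambda>\<close>, so the equilibrium capacity is the point where the
  increasing line \<open>(r + \<delta>) (\<alpha> + \<delta> k / \<lambda>)\<close> meets the decreasing payoff. For \<open>k > 0\<close> the
  monopoly payoff lies strictly below the competitive one because \<open>\<epsilon> / (k + \<epsilon>) < 1\<close>, so the line
  meets it earlier.
\<close>

definition stationary_capacity ::
    "real \<Rightarrow> real \<Rightarrow> real \<Rightarrow> real \<Rightarrow> (real \<Rightarrow> real) \<Rightarrow> real \<Rightarrow> bool" where
  "stationary_capacity r \<delta> lam \<alpha> f k \<longleftrightarrow> k \<ge> 0 \<and> (r + \<delta>) * (\<alpha> + \<delta> * k / lam) = f k"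

lemma stationary_line_strict_mono:
  fixes r \<delta> lam \<alpha> x y :: real
  assumes "r > 0" "\<delta> > 0" "lam > 0" "x < y"
  shows "(r + \<delta>) * (\<alpha> + \<delta> * x / lam) < (r + \<delta>) * (\<alpha> + \<delta> * y / lam)"
  using assms by (intro mult_strict_left_mono add_strict_left_mono divide_strict_right_mono) auto

text \<open>If \<open>y < x\<close>, the line at \<open>x\<close> lies strictly above the line at
  \<open>y\<close>, while \<open>f x \<le> g x \<le> g y\<close> says the opposite. Comparing the
  payoffs only at \<open>x\<close> suffices, and taking \<open>g = f\<close> gives
  uniqueness.\<close>

lemma stationary_capacity_le:
  assumes "r > 0" "\<delta> > 0" "lam > 0" "antimono_on {0..} g"
    and "stationary_capacity r \<delta> lam \<alpha> f x" "stationary_capacity r \<delta> lam \<alpha> g y" "f x \<le> g x"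
  shows "x \<le> y"
proof (rule ccontr)
  assume "\<not> x \<le> y"
  then have "y < x" by simp
  then have "(r + \<delta>) * (\<alpha> + \<delta> * y / lam) < (r + \<delta>) * (\<alpha> + \<delta> * x / lam)"
    by (rule stationary_line_strict_mono[OF assms(1-3)])
  moreover have "g x \<le> g y"
    using assms(4-6) \<open>y < x\<close> by (simp add: monotone_on_def stationary_capacity_def)
  ultimately show False
    using assms(5-7) unfolding stationary_capacity_def by linarith
qed

lemma stationary_capacity_less:
  assumes "r > 0" "\<delta> > 0" "lam > 0" "antimono_on {0..} g"
    and "stationary_capacity r \<delta> lam \<alpha> f x" "stationary_capacity r \<delta> lam \<alpha> g y" "f x < g x"
  shows "x < y"
proof -
  have "x \<le> y"
    using stationary_capacity_le[OF assms(1-6)] assms(7) by simp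
  \<comment> \<open>At a common point, both payoffs would equal the same value of the line.\<close>
  moreover have "x \<noteq> y"
    using assms(5-7) unfolding stationary_capacity_def by auto
  ultimately show ?thesis by simp
qed

lemma stationary_capacity_unique:
  assumes "r > 0" "\<delta> > 0" "lam > 0" "antimono_on {0..} f"
    and "stationary_capacity r \<delta> lam \<alpha> f x" "stationary_capacity r \<delta> lam \<alpha> f y"
  shows "x = y"
  using stationary_capacity_le[OF assms(1-6)] stationary_capacity_le[OF assms(1-4,6,5)] by simp

lemma stationary_capacity_exists:
  assumes "r > 0" "\<delta> > 0" "lam > 0" "\<alpha> \<ge> 0"
    and "antimono_on {0..} f" "continuous_on {0..} f" "(r + \<delta>) * \<alpha> < f 0"
  obtains k where "stationary_capacity r \<delta> lam \<alpha> f k"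
proof -
  \<comment> \<open>At \<open>b\<close> the line without its constant term reaches
    \<open>f 0\<close>. Since \<alpha> \<ge> 0, the full line is there at least \<open>f 0\<close>,
    hence at least \<open>f b\<close>, so the two curves cross on \<open>{0..b}\<close>.\<close>
  define b where "b = f 0 * lam / ((r + \<delta>) * \<delta>)"
  have "0 \<le> (r + \<delta>) * \<alpha>" using assms by simp
  then have "0 < f 0" using assms(7) by linarith
  then have "0 \<le> b" using assms(1-3) by (simp add: b_def)
  have "(r + \<delta>) * (\<delta> * b / lam) = f 0"
    using assms(1-3) by (simp add: b_def)
  then have "(r + \<delta>) * (\<alpha> + \<delta> * b / lam) \<ge> f 0"
    using \<open>0 \<le> (r + \<delta>) * \<alpha>\<close> by (simp add: distrib_left)
  moreover have "f b \<le> f 0"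
    using assms(5) \<open>0 \<le> b\<close> by (simp add: monotone_on_def)
  ultimately have "f b - (r + \<delta>) * (\<alpha> + \<delta> * b / lam) \<le> 0" by simp
  moreover have "0 \<le> f 0 - (r + \<delta>) * (\<alpha> + \<delta> * 0 / lam)" using assms by simp
  moreover have "continuous_on {0..b} (\<lambda>k. f k - (r + \<delta>) * (\<alpha> + \<delta> * k / lam))"
    using assms(3) continuous_on_subset[OF assms(6), of "{0..b}"]
    by (auto intro!: continuous_intros)
  ultimately obtain k where "0 \<le> k" "f k - (r + \<delta>) * (\<alpha> + \<delta> * k / lam) = 0"
    using IVT2'[of "\<lambda>k. f k - (r + \<delta>) * (\<alpha> + \<delta> * k / lam)" b 0 0] \<open>0 \<le> b\<close> by auto
  then show ?thesis by (intro that[of k]) (simp add: stationary_capacity_def)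
qed

text \<open>The first equation determines \<open>u\<close> from \<open>k\<close>. This is used with
  \<open>u\<close> free, to evaluate the stationary pair, and with \<open>u = U k\<close>, to treat
  the zero of the drift of a value function.\<close>

lemma stationary_capacity_iff:
  assumes "lam > 0"
  shows "k \<ge> 0 \<and> lam * (u - \<alpha>) - \<delta> * k = 0 \<and> (r + \<delta>) * u = f k \<longleftrightarrow>
    stationary_capacity r \<delta> lam \<alpha> f k \<and> u = \<alpha> + \<delta> * k / lam"
proof -
  have "lam * (u - \<alpha>) - \<delta> * k = 0 \<longleftrightarrow> u = \<alpha> + \<delta> * k / lam"
    using assms by (auto simp: field_simps)
  then show ?thesis by (auto simp: stationary_capacity_def)
qed

lemma fst_stationary_pair:
  assumes "r > 0" "\<delta> > 0" "lam > 0" "antimono_on {0..} f" "stationary_capacity r \<delta> lam \<alpha> f k"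
  shows "fst (stationary_pair r \<delta> lam \<alpha> f) = k"
proof -
  have "stationary_pair r \<delta> lam \<alpha> f = (k, \<alpha> + \<delta> * k / lam)"
    unfolding stationary_pair_def stationary_capacity_iff[OF assms(3)]
    using stationary_capacity_unique[OF assms(1-4)] assms(5)
    by (intro the_equality) auto
  then show ?thesis by simp
qed

text \<open>The difference quotients to the right of \<open>a\<close> are nonpositive, and so is
  their limit. This is the one-sided derivative needed at the boundary point 0.\<close>

lemma antimono_on_has_real_derivative_nonpos:
  fixes U :: "real \<Rightarrow> real"
  assumes "antimono_on {a..} U" "(U has_real_derivative D) (at a within {a..})"
  shows "D \<le> 0"
proof (rule tendsto_upperbound)
  show "((\<lambda>y. (U y - U a) / (y - a)) \<longlongrightarrow> D) (at a within {a..})"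
    using assms(2) by (simp add: has_field_derivative_iff)
  show "\<forall>\<^sub>F y in at a within {a..}. (U y - U a) / (y - a) \<le> 0"
    using assms(1) by (auto simp: eventually_at_filter monotone_on_def divide_le_0_iff)
  show "at a within {a..} \<noteq> bot"
    by (simp add: at_within_Ici_at_right)
qed

text \<open>
  Were the drift negative at \<open>0\<close>, the transport term would be nonnegative there and the equation
  would force \<open>U 0 > \<alpha>\<close>. Hence the drift starts nonnegative and has a zero.
\<close>

lemma equilibrium_capacity_stationary:
  assumes "r > 0" "\<delta> > 0" "lam > 0" "(r + \<delta>) * \<alpha> < f 0" "value_function r \<delta> lam \<alpha> f U"
  shows "stationary_capacity r \<delta> lam \<alpha> f (equilibrium_capacity \<delta> lam \<alpha> U)"
proof -
  define G where "G k = lam * (U k - \<alpha>) - \<delta> * k" for k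
  obtain L where "L-lipschitz_on {0..} U"
    using assms(5) by (auto simp: value_function_def)
  then have cont: "continuous_on {0..} U" by (rule lipschitz_on_continuous_on)
  have anti: "antimono_on {0..} U"
    using assms(5) by (simp add: value_function_def)
  have ode: "\<exists>D. (U has_real_derivative D) (at k within {0..}) \<and>
        - (r + \<delta>) * U k + (lam * (U k - \<alpha>) - \<delta> * k) * D + f k = 0" if "k \<ge> 0" for k
    using assms(5) that by (auto simp: value_function_def)
  have "\<alpha> \<le> U 0"
  proof (rule ccontr)
    assume "\<not> \<alpha> \<le> U 0"
    obtain D where D: "(U has_real_derivative D) (at 0 within {0..})"
      "- (r + \<delta>) * U 0 + lam * (U 0 - \<alpha>) * D + f 0 = 0"
      using ode[of 0] by auto
    have "D \<le> 0" using antimono_on_has_real_derivative_nonpos[OF anti D(1)] by simp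
    then have "0 \<le> lam * (U 0 - \<alpha>) * D"
      using assms(3) \<open>\<not> \<alpha> \<le> U 0\<close> by (intro mult_nonpos_nonpos mult_nonneg_nonpos) auto
    then have "(r + \<delta>) * \<alpha> < (r + \<delta>) * U 0" using D(2) assms(4) by (simp add: algebra_simps)
    then show False
      using assms(1,2) \<open>\<not> \<alpha> \<le> U 0\<close> by (simp add: mult_less_cancel_left)
  qed
  \<comment> \<open>Beyond \<open>b\<close> the depreciation \<delta> k exceeds lam (U 0 -
    \<alpha>), the largest value of the investment term, so the drift \<open>G\<close> changes sign
    on \<open>{0..b}\<close>.\<close>
  define b where "b = lam * (U 0 - \<alpha>) / \<delta>"
  have "0 \<le> b" using assms(2,3) \<open>\<alpha> \<le> U 0\<close> by (simp add: b_def)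
  \<comment> \<open>Strict decrease makes the zero of \<open>G\<close> unique, so that the
    description defining \<open>equilibrium_capacity\<close> denotes it.\<close>
  have less: "G y < G x" if "0 \<le> x" "x < y" for x y
  proof -
    have "U y \<le> U x" using anti that by (simp add: monotone_on_def)
    then have "lam * (U y - \<alpha>) \<le> lam * (U x - \<alpha>)" using assms(3) by simp
    moreover have "\<delta> * x < \<delta> * y" using assms(2) that by simp
    ultimately show ?thesis by (simp add: G_def)
  qed
  have "lam * (U b - \<alpha>) \<le> lam * (U 0 - \<alpha>)"
    using anti \<open>0 \<le> b\<close> assms(3) by (simp add: monotone_on_def)
  also have "\<dots> = \<delta> * b" using assms(2) by (simp add: b_def)
  finally have "G b \<le> 0" by (simp add: G_def)
  moreover have "0 \<le> G 0" using assms(3) \<open>\<alpha> \<le> U 0\<close> by (simp add: G_def)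
  moreover have "continuous_on {0..b} G"
    unfolding G_def using continuous_on_subset[OF cont, of "{0..b}"]
    by (auto intro!: continuous_intros)
  ultimately obtain k where k: "0 \<le> k" "G k = 0"
    using IVT2'[of G b 0 0] \<open>0 \<le> b\<close> by auto
  have "equilibrium_capacity \<delta> lam \<alpha> U = k"
    unfolding equilibrium_capacity_def G_def[symmetric]
  proof (rule the_equality)
    show "k' = k" if "k' \<ge> 0 \<and> G k' = 0" for k'
      using that k less[of k k'] less[of k' k] by (cases k k' rule: linorder_cases) auto
  qed (use k in simp)
  moreover have "stationary_capacity r \<delta> lam \<alpha> f k"
  proof -
    \<comment> \<open>The factor of \<open>D\<close> is \<open>G k = 0\<close>, so the transport
      term vanishes whatever the derivative is.\<close>
    have "(r + \<delta>) * U k = f k"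
      using ode[OF k(1)] k(2) by (auto simp: G_def algebra_simps)
    with k stationary_capacity_iff[OF assms(3), of k "U k" \<alpha> \<delta> r f] show ?thesis
      by (simp add: G_def)
  qed
  ultimately show ?thesis by simp
qed

lemma antimono_on_agents_payoff:
  assumes "\<epsilon> > 0" "h > 0" "p > 0"
  shows "antimono_on {0..} (agents_payoff \<epsilon> h p c)"
proof (rule monotone_onI)
  fix x y :: real
  assume "x \<in> {0..}" "x \<le> y"
  then have "p / (y + \<epsilon>) \<le> p / (x + \<epsilon>)"
    using assms by (intro divide_left_mono) auto
  then show "agents_payoff \<epsilon> h p c y \<le> agents_payoff \<epsilon> h p c x"
    unfolding agents_payoff_def using assms by (intro mult_left_mono) auto
qed

lemma antimono_on_mono_payoff:
  assumes "\<epsilon> > 0" "h > 0" "p > 0"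
  shows "antimono_on {0..} (mono_payoff \<epsilon> h p c)"
proof (rule monotone_onI)
  fix x y :: real
  assume "x \<in> {0..}" "x \<le> y"
  then have "h * p * \<epsilon> / (y + \<epsilon>)^2 \<le> h * p * \<epsilon> / (x + \<epsilon>)^2"
    using assms by (intro divide_left_mono power_mono mult_pos_pos) auto
  then show "mono_payoff \<epsilon> h p c y \<le> mono_payoff \<epsilon> h p c x"
    unfolding mono_payoff_def by simp
qed

lemma continuous_on_agents_payoff:
  assumes "\<epsilon> > 0"
  shows "continuous_on {0..} (agents_payoff \<epsilon> h p c)"
  unfolding agents_payoff_def using assms by (auto intro!: continuous_intros)

lemma continuous_on_mono_payoff:
  assumes "\<epsilon> > 0"
  shows "continuous_on {0..} (mono_payoff \<epsilon> h p c)"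
  unfolding mono_payoff_def using assms by (auto intro!: continuous_intros)

text \<open>Over the common denominator the numerators compare as \<epsilon> < k + \<epsilon>, which
  is strict only for \<open>k > 0\<close>. Taking the positive part can only raise the competitive
  payoff.\<close>

lemma mono_payoff_less_agents_payoff:
  assumes "\<epsilon> > 0" "h > 0" "p > 0" "k > 0"
  shows "mono_payoff \<epsilon> h p c k < agents_payoff \<epsilon> h p c k"
proof -
  have "h * p * \<epsilon> / (k + \<epsilon>)^2 < h * p * (k + \<epsilon>) / (k + \<epsilon>)^2"
    using assms by (intro divide_strict_right_mono mult_strict_left_mono) auto
  also have "\<dots> = h * (p / (k + \<epsilon>))"
    using assms by (simp add: power2_eq_square)
  finally have "mono_payoff \<epsilon> h p c k < h * (p / (k + \<epsilon>) - c)"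
    by (simp add: mono_payoff_def right_diff_distrib)
  also have "\<dots> \<le> agents_payoff \<epsilon> h p c k"
    unfolding agents_payoff_def using assms(2) by (intro mult_left_mono) auto
  finally show ?thesis .
qed

theorem theorem6:
  fixes r \<delta> lam \<epsilon> h p c \<alpha> :: real
  assumes "r > 0" and "\<delta> > 0" and "lam > 0" and "\<epsilon> > 0" and "h > 0" and "p > 0"
    and "\<alpha> \<ge> 0" and "h * c + \<alpha> * (r + \<delta>) < h * p / \<epsilon>"
  shows "k_mono r \<delta> lam \<epsilon> h p c \<alpha> < k_agents r \<delta> lam \<epsilon> h p c \<alpha> \<and>
    (\<forall>U_mono U_agents.
       value_function r \<delta> lam \<alpha> (mono_payoff \<epsilon> h p c) U_mono \<longrightarrow>
       value_function r \<delta> lam \<alpha> (agents_payoff \<epsilon> h p c) U_agents \<longrightarrow>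
       equilibrium_capacity \<delta> lam \<alpha> U_mono < equilibrium_capacity \<delta> lam \<alpha> U_agents)"
proof -
  note pos = assms(1-3)
  note payoff_pos = assms(4-6)
  note anti_mono = antimono_on_mono_payoff[OF payoff_pos, of c]
  note anti_agents = antimono_on_agents_payoff[OF payoff_pos, of c]
  \<comment> \<open>At \<open>k = 0\<close> the monopoly payoff is h p / \<epsilon> - h c, so this
    is the admissibility condition rearranged.\<close>
  have mono_0: "(r + \<delta>) * \<alpha> < mono_payoff \<epsilon> h p c 0"
    using assms(4,8) by (simp add: mono_payoff_def power2_eq_square mult.commute)
  have "h * (p / \<epsilon> - c) \<le> agents_payoff \<epsilon> h p c 0"
    unfolding agents_payoff_def using assms(5) by (intro mult_left_mono) auto
  then have agents_0: "(r + \<delta>) * \<alpha> < agents_payoff \<epsilon> h p c 0"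
    using assms(8) by (simp add: algebra_simps)
  \<comment> \<open>Stated for arbitrary stationary capacities, so that it yields both halves of the
    conclusion.\<close>
  have less: "x < y"
    if "stationary_capacity r \<delta> lam \<alpha> (mono_payoff \<epsilon> h p c) x"
      and "stationary_capacity r \<delta> lam \<alpha> (agents_payoff \<epsilon> h p c) y" for x y
  proof -
    \<comment> \<open>The line starts strictly below the monopoly payoff, so 0 is not stationary and
      the strict payoff comparison applies at \<open>x\<close>.\<close>
    have "x > 0"
      using that(1) mono_0 by (cases "x = 0") (auto simp: stationary_capacity_def)
    then show ?thesis
      using stationary_capacity_less[OF pos anti_agents that]
        mono_payoff_less_agents_payoff[OF payoff_pos] by blast
  qed
  \<comment> \<open>Existence ensures that the descriptions defining the two stationary pairs denote
    actual solutions.\<close>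
  obtain km where km: "stationary_capacity r \<delta> lam \<alpha> (mono_payoff \<epsilon> h p c) km"
    using stationary_capacity_exists[OF pos assms(7) anti_mono
        continuous_on_mono_payoff[OF assms(4)] mono_0] .
  obtain ka where ka: "stationary_capacity r \<delta> lam \<alpha> (agents_payoff \<epsilon> h p c) ka"
    using stationary_capacity_exists[OF pos assms(7) anti_agents
        continuous_on_agents_payoff[OF assms(4)] agents_0] .
  have "k_mono r \<delta> lam \<epsilon> h p c \<alpha> < k_agents r \<delta> lam \<epsilon> h p c \<alpha>"
    using less[OF km ka] fst_stationary_pair[OF pos anti_mono km]
      fst_stationary_pair[OF pos anti_agents ka]
    by (simp add: k_mono_def k_agents_def)
  then show ?thesis
    using less equilibrium_capacity_stationary[of r \<delta> lam \<alpha>, OF pos] mono_0 agents_0 by blast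
qed

end
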